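(* For every positive integer $n$, the grammic monoid of rank $n$ is a quotient of the left patience sorting monoid of rank $n$.
   Context: Write $[n]=\{1<2<\cdots<n\}$, $[n]^*$ for the free monoid on $[n]$, $\mathbb{N}_0$ for the non-negative integers. Grammic monoid: each letter $a\in[n]$ acts on $\mathbb{N}_0^n$ on the right: for $\gamma\in\mathbb{N}_0^n$ let $t=\min\{s\in[n]: s>a,\ \gamma_s>0\}$ if this set is non-empty; then $\gamma\cdot a=\gamma+e_a-e_t$ if $t$ is defined, and $\gamma\cdot a=\gamma+e_a$ otherwise, where $e_i$ is the $i$th standard basis vector. This extends to words by $\gamma\cdot\varepsilon=\gamma$ and $\gamma\cdot(w_1\cdots w_k)=(\cdots(\gamma\cdot w_1)\cdots)\cdot w_k$. For $u,v\in[n]^*$, $u\equiv_{\rm gram}v$ means $\gamma\cdot u=\gamma\cdot v$ for all $\gamma\in\mathbb{N}_0^n$. The grammic monoid of rank $n$ is $[n]^*/\equiv_{\rm gram}$. The left patience sorting monoid of rank $n$ is the monoid generated by $[n]$ subject to the relations $$\{(yu_m\cdots u_1x,\ yxu_m\cdots u_1): m\geq 1,\ x,y,u_i\in[n],\ x<y\leq u_1<u_2<\cdots<u_m\}.$$ *)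

theory Defs
  imports "HOL-Algebra.Group" "HOL-Library.FuncSet"
begin

section \<open>Monoid congruences, quotients and presentations\<close>

definition free_monoid :: "'a set \<Rightarrow> 'a list monoid"
  where "free_monoid A = \<lparr>carrier = lists A, mult = (@), one = []\<rparr>"

definition monoid_congruence :: "('a, 'b) monoid_scheme \<Rightarrow> ('a \<times> 'a) set \<Rightarrow> bool"
  where "monoid_congruence M r \<longleftrightarrow>
    equiv (carrier M) r \<and>
    (\<forall>x x' y y'. (x, x') \<in> r \<longrightarrow> (y, y') \<in> r \<longrightarrow> (x \<otimes>\<^bsub>M\<^esub> y, x' \<otimes>\<^bsub>M\<^esub> y') \<in> r)"

definition generated_congruence ::
    "('a, 'b) monoid_scheme \<Rightarrow> ('a \<times> 'a) set \<Rightarrow> ('a \<times> 'a) set"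
  where "generated_congruence M R = \<Inter>{r. monoid_congruence M r \<and> R \<subseteq> r}"

(* For a congruence r, the union below is the single class of x \<otimes> y,
   for any choice of x \<in> X and y \<in> Y. *)
definition quotient_monoid :: "('a, 'b) monoid_scheme \<Rightarrow> ('a \<times> 'a) set \<Rightarrow> 'a set monoid"
  where "quotient_monoid M r =
    \<lparr>carrier = carrier M // r,
     mult = (\<lambda>X Y. \<Union>x\<in>X. \<Union>y\<in>Y. r `` {x \<otimes>\<^bsub>M\<^esub> y}),
     one = r `` {\<one>\<^bsub>M\<^esub>}\<rparr>"

(* For monoids, the multiplicative bijections of iso automatically preserve the unit. *)
definition is_quotient_of :: "('a, 'b) monoid_scheme \<Rightarrow> ('c, 'd) monoid_scheme \<Rightarrow> bool"
  where "is_quotient_of N M \<longleftrightarrow> (\<exists>r. monoid_congruence M r \<and> quotient_monoid M r \<cong> N)"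


section \<open>The grammic monoid\<close>

definition gram_vectors :: "nat \<Rightarrow> (nat \<Rightarrow> nat) set"
  where "gram_vectors n = {1..n} \<rightarrow>\<^sub>E UNIV"

definition gram_act :: "nat \<Rightarrow> (nat \<Rightarrow> nat) \<Rightarrow> nat \<Rightarrow> (nat \<Rightarrow> nat)"
  where "gram_act n g a =
    (let S = {s \<in> {1..n}. s > a \<and> g s > 0} in
     if S = {} then g(a := g a + 1)
     else g(a := g a + 1, Min S := g (Min S) - 1))"

definition gram_act_word :: "nat \<Rightarrow> (nat \<Rightarrow> nat) \<Rightarrow> nat list \<Rightarrow> (nat \<Rightarrow> nat)"
  where "gram_act_word n g w = foldl (gram_act n) g w"

definition gram_congruence :: "nat \<Rightarrow> (nat list \<times> nat list) set"
  where "gram_congruence n =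
    {(u, v). u \<in> lists {1..n} \<and> v \<in> lists {1..n} \<and>
       (\<forall>g \<in> gram_vectors n. gram_act_word n g u = gram_act_word n g v)}"

definition grammic_monoid :: "nat \<Rightarrow> nat list set monoid"
  where "grammic_monoid n = quotient_monoid (free_monoid {1..n}) (gram_congruence n)"


section \<open>The left patience sorting monoid\<close>

(* us is the list [u_1, ..., u_m]. *)
definition lps_relations :: "nat \<Rightarrow> (nat list \<times> nat list) set"
  where "lps_relations n =
    {(y # rev us @ [x], y # x # rev us) | x y us.
       x \<in> {1..n} \<and> y \<in> {1..n} \<and> set us \<subseteq> {1..n} \<and>
       us \<noteq> [] \<and> x < y \<and> y \<le> hd us \<and> sorted_wrt (<) us}"

definition lps_congruence :: "nat \<Rightarrow> (nat list \<times> nat list) set"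
  where "lps_congruence n = generated_congruence (free_monoid {1..n}) (lps_relations n)"

definition lps_monoid :: "nat \<Rightarrow> nat list set monoid"
  where "lps_monoid n = quotient_monoid (free_monoid {1..n}) (lps_congruence n)"

end

(* If the entry of a vector at y is positive, a letter x < y only looks at and changes entries up to y,
   whereas a letter u \<ge> y looks only at entries beyond u and changes only entries from u on; apart
   from an increment at y nothing interferes, so u and x commute on such vectors. The letter y makes
   its own entry positive and letters u \<ge> y never decrease it, so in y u_m ... u_1 x the letter x can
   be moved to the left, one u_i at a time. Hence the grammic congruence contains the relations of
   the left patience sorting monoid, and the third isomorphism theorem applies. *)
theory Submission
  imports Defs
begin

section \<open>Congruences\<close>

lemma monoid_congruence_equiv: "monoid_congruence M r \<Longrightarrow> equiv (carrier M) r"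
  by (simp add: monoid_congruence_def)

lemma monoid_congruence_mult:
  "monoid_congruence M r \<Longrightarrow> (x, x') \<in> r \<Longrightarrow> (y, y') \<in> r \<Longrightarrow> (x \<otimes>\<^bsub>M\<^esub> y, x' \<otimes>\<^bsub>M\<^esub> y') \<in> r"
  by (simp add: monoid_congruence_def)

lemma monoid_congruence_carrier:
  assumes "monoid_congruence M r" "(x, y) \<in> r"
  shows "x \<in> carrier M" "y \<in> carrier M"
  using assms monoid_congruence_equiv[OF assms(1)] equiv_type by blast+

lemma monoid_congruence_refl:
  "monoid_congruence M r \<Longrightarrow> x \<in> carrier M \<Longrightarrow> (x, x) \<in> r"
  by (meson monoid_congruence_equiv equiv_def refl_onD)

lemma monoid_congruence_sym:
  "monoid_congruence M r \<Longrightarrow> (x, y) \<in> r \<Longrightarrow> (y, x) \<in> r"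
  by (meson monoid_congruence_equiv equiv_def symD)

lemma monoid_congruence_trans:
  "monoid_congruence M r \<Longrightarrow> (x, y) \<in> r \<Longrightarrow> (y, z) \<in> r \<Longrightarrow> (x, z) \<in> r"
  by (meson monoid_congruence_equiv equiv_def transD)

text \<open>\<open>M\<close> is an arbitrary record here, not assumed to be a monoid. Closure comes
  from multiplying the pairs \<open>(x, x)\<close> and \<open>(y, y)\<close> inside
  \<open>r\<close>, all of whose pairs lie over the carrier.\<close>

lemma monoid_congruence_closed:
  assumes "monoid_congruence M r" "x \<in> carrier M" "y \<in> carrier M"
  shows "x \<otimes>\<^bsub>M\<^esub> y \<in> carrier M"
  using assms monoid_congruence_mult monoid_congruence_refl monoid_congruence_carrier by metis

lemma monoid_congruence_class_eq_iff:
  assumes "monoid_congruence M r" "x \<in> carrier M" "y \<in> carrier M"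
  shows "r `` {x} = r `` {y} \<longleftrightarrow> (x, y) \<in> r"
  using assms monoid_congruence_equiv eq_equiv_class_iff by metis

lemma monoid_congruenceI:
  assumes "r \<subseteq> carrier M \<times> carrier M"
    and "\<And>x. x \<in> carrier M \<Longrightarrow> (x, x) \<in> r"
    and "\<And>x y. (x, y) \<in> r \<Longrightarrow> (y, x) \<in> r"
    and "\<And>x y z. (x, y) \<in> r \<Longrightarrow> (y, z) \<in> r \<Longrightarrow> (x, z) \<in> r"
    and "\<And>x x' y y'. (x, x') \<in> r \<Longrightarrow> (y, y') \<in> r \<Longrightarrow> (x \<otimes>\<^bsub>M\<^esub> y, x' \<otimes>\<^bsub>M\<^esub> y') \<in> r"
  shows "monoid_congruence M r"
  unfolding monoid_congruence_def
  using assms by (intro conjI equivI refl_onI symI transI allI impI) blast+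

(* The bounding congruence s ensures that the intersection is not over the empty family. *)
lemma monoid_congruence_generated:
  assumes s: "monoid_congruence M s" "R \<subseteq> s"
  shows "monoid_congruence M (generated_congruence M R)"
proof (rule monoid_congruenceI)
  show "generated_congruence M R \<subseteq> carrier M \<times> carrier M"
    unfolding generated_congruence_def using s monoid_congruence_carrier[OF s(1)] by auto
next
  fix x y z x' y' :: 'a
  let ?G = "generated_congruence M R"
  \<comment> \<open>In this form each closure property is inherited from the individual congruences
    \<open>r\<close> over \<open>R\<close>.\<close>
  have G: "(u, v) \<in> ?G \<longleftrightarrow> (\<forall>r. monoid_congruence M r \<and> R \<subseteq> r \<longrightarrow> (u, v) \<in> r)" for u v
    unfolding generated_congruence_def by blast
  show "x \<in> carrier M \<Longrightarrow> (x, x) \<in> ?G"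
    unfolding G by (intro allI impI) (rule monoid_congruence_refl, simp_all)
  show "(x, y) \<in> ?G \<Longrightarrow> (y, x) \<in> ?G"
    unfolding G by (intro allI impI) (rule monoid_congruence_sym[where M = M], simp_all)
  show "(x, y) \<in> ?G \<Longrightarrow> (y, z) \<in> ?G \<Longrightarrow> (x, z) \<in> ?G"
    unfolding G by (intro allI impI) (rule monoid_congruence_trans[where M = M and y = y], simp_all)
  show "(x, x') \<in> ?G \<Longrightarrow> (y, y') \<in> ?G \<Longrightarrow> (x \<otimes>\<^bsub>M\<^esub> y, x' \<otimes>\<^bsub>M\<^esub> y') \<in> ?G"
    unfolding G by (intro allI impI) (rule monoid_congruence_mult, simp_all)
qed

lemma generated_congruence_least:
  "monoid_congruence M s \<Longrightarrow> R \<subseteq> s \<Longrightarrow> generated_congruence M R \<subseteq> s"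
  unfolding generated_congruence_def by auto

section \<open>The third isomorphism theorem\<close>

lemma carrier_quotient_monoid: "carrier (quotient_monoid M r) = (\<lambda>x. r `` {x}) ` carrier M"
  by (auto simp: quotient_monoid_def quotient_def)

lemma mult_quotient_monoid:
  assumes r: "monoid_congruence M r" and "x \<in> carrier M" "y \<in> carrier M"
  shows "r `` {x} \<otimes>\<^bsub>quotient_monoid M r\<^esub> r `` {y} = r `` {x \<otimes>\<^bsub>M\<^esub> y}"
proof -
  have "r `` {x' \<otimes>\<^bsub>M\<^esub> y'} = r `` {x \<otimes>\<^bsub>M\<^esub> y}" if "(x, x') \<in> r" "(y, y') \<in> r" for x' y'
    using monoid_congruence_mult[OF r that] monoid_congruence_equiv[OF r] equiv_class_eq by metis
  then have "(\<Union>x'\<in>r `` {x}. \<Union>y'\<in>r `` {y}. r `` {x' \<otimes>\<^bsub>M\<^esub> y'}) =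
      (\<Union>x'\<in>r `` {x}. \<Union>y'\<in>r `` {y}. r `` {x \<otimes>\<^bsub>M\<^esub> y})"
    by (intro SUP_cong refl) simp
  \<comment> \<open>The index sets are non-empty, so the union of the constant family is that one
    class.\<close>
  moreover have "x \<in> r `` {x}" "y \<in> r `` {y}"
    using assms monoid_congruence_refl by fast+
  ultimately show ?thesis
    unfolding quotient_monoid_def by auto
qed

text \<open>This is the congruence s/r of the third isomorphism theorem, encoded as the image of
  \<open>s\<close> under passing to \<open>r\<close>-classes.\<close>

definition quotient_congruence :: "('a \<times> 'a) set \<Rightarrow> ('a \<times> 'a) set \<Rightarrow> ('a set \<times> 'a set) set"
  where "quotient_congruence s r = (\<lambda>(x, y). (r `` {x}, r `` {y})) ` s"

context
  fixes M :: "('a, 'b) monoid_scheme" and r s :: "('a \<times> 'a) set"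
  assumes r: "monoid_congruence M r" and s: "monoid_congruence M s" and rs: "r \<subseteq> s"
begin

text \<open>The image only provides some representatives related by \<open>s\<close>. Exchanging
  them for \<open>x\<close> and \<open>y\<close> moves within \<open>r\<close>-classes, hence within
  \<open>s\<close>-classes because \<open>r\<close> is contained in \<open>s\<close>.\<close>

lemma quotient_congruence_iff:
  assumes "x \<in> carrier M" "y \<in> carrier M"
  shows "(r `` {x}, r `` {y}) \<in> quotient_congruence s r \<longleftrightarrow> (x, y) \<in> s"
proof
  assume "(r `` {x}, r `` {y}) \<in> quotient_congruence s r"
  then obtain x' y' where xy: "(x', y') \<in> s" "r `` {x} = r `` {x'}" "r `` {y} = r `` {y'}"
    unfolding quotient_congruence_def by auto
  then have "(x, x') \<in> s" "(y', y) \<in> s"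
    using monoid_congruence_class_eq_iff[OF r] monoid_congruence_carrier[OF s xy(1)] assms rs
    by blast+
  with xy(1) show "(x, y) \<in> s" using monoid_congruence_trans[OF s] by blast
qed (auto simp: quotient_congruence_def)

lemma monoid_congruence_quotient:
  "monoid_congruence (quotient_monoid M r) (quotient_congruence s r)"
proof (rule monoid_congruenceI)
  show sub: "quotient_congruence s r \<subseteq> carrier (quotient_monoid M r) \<times> carrier (quotient_monoid M r)"
    unfolding quotient_congruence_def carrier_quotient_monoid
    using monoid_congruence_carrier[OF s] by auto
  show "(X, X) \<in> quotient_congruence s r" if "X \<in> carrier (quotient_monoid M r)" for X
    using that monoid_congruence_refl[OF s]
    by (auto simp: carrier_quotient_monoid quotient_congruence_iff)
  show "(Y, X) \<in> quotient_congruence s r" if "(X, Y) \<in> quotient_congruence s r" for X Y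
    using that monoid_congruence_sym[OF s] by (auto simp: quotient_congruence_def)
  show "(X, Z) \<in> quotient_congruence s r"
    if XY: "(X, Y) \<in> quotient_congruence s r" and YZ: "(Y, Z) \<in> quotient_congruence s r" for X Y Z
  proof -
    \<comment> \<open>One representative of \<open>Y\<close> is fixed for both pairs; unfolding the
      image directly would give two unrelated ones.\<close>
    obtain x y z where "x \<in> carrier M" "X = r `` {x}" "y \<in> carrier M" "Y = r `` {y}"
        "z \<in> carrier M" "Z = r `` {z}"
      using XY YZ sub unfolding carrier_quotient_monoid by blast
    then show ?thesis
      using XY YZ monoid_congruence_trans[OF s] by (auto simp: quotient_congruence_iff)
  qed
  show "(X \<otimes>\<^bsub>quotient_monoid M r\<^esub> Y, X' \<otimes>\<^bsub>quotient_monoid M r\<^esub> Y') \<in> quotient_congruence s r"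
    if X: "(X, X') \<in> quotient_congruence s r" and Y: "(Y, Y') \<in> quotient_congruence s r" for X X' Y Y'
  proof -
    obtain x x' y y' where "(x, x') \<in> s" "X = r `` {x}" "X' = r `` {x'}"
        "(y, y') \<in> s" "Y = r `` {y}" "Y' = r `` {y'}"
      using X Y unfolding quotient_congruence_def by auto
    then show ?thesis
      using monoid_congruence_mult[OF s] monoid_congruence_carrier[OF s]
      by (simp add: mult_quotient_monoid[OF r] quotient_congruence_iff monoid_congruence_closed[OF r])
  qed
qed

text \<open>The \<open>r\<close>-classes related to that of \<open>x\<close> lie inside the
  \<open>s\<close>-class of \<open>x\<close> and cover it. Hence \<open>Union\<close> is the
  canonical map from the double quotient to the quotient by \<open>s\<close>.\<close>

lemma Union_quotient_congruence_class:
  assumes "x \<in> carrier M"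
  shows "\<Union> (quotient_congruence s r `` {r `` {x}}) = s `` {x}"
proof -
  have "z \<in> s `` {x}" if Y: "(r `` {x}, Y) \<in> quotient_congruence s r" and z: "z \<in> Y" for z Y
  proof -
    obtain y where y: "y \<in> carrier M" "Y = r `` {y}"
      using monoid_congruence_carrier(2)[OF monoid_congruence_quotient Y]
      by (auto simp: carrier_quotient_monoid)
    then have "(x, y) \<in> s" "(y, z) \<in> s"
      using Y z rs assms by (auto simp: quotient_congruence_iff)
    then show ?thesis using monoid_congruence_trans[OF s] by blast
  qed
  moreover have "z \<in> \<Union> (quotient_congruence s r `` {r `` {x}})" if "(x, z) \<in> s" for z
    using that monoid_congruence_refl[OF r monoid_congruence_carrier(2)[OF s that]]
    by (auto simp: quotient_congruence_def)
  ultimately show ?thesis by blast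
qed

lemma is_quotient_of_quotient_monoid:
  "is_quotient_of (quotient_monoid M s) (quotient_monoid M r)"
proof -
  let ?Q = "quotient_congruence s r"
  let ?MQ = "quotient_monoid (quotient_monoid M r) ?Q"
  note Q = monoid_congruence_quotient
  have class_in: "r `` {x} \<in> carrier (quotient_monoid M r)" if "x \<in> carrier M" for x
    using that by (auto simp: carrier_quotient_monoid)
  have carr: "carrier ?MQ = (\<lambda>x. ?Q `` {r `` {x}}) ` carrier M"
    by (simp add: carrier_quotient_monoid image_image)
  have "Union \<in> iso ?MQ (quotient_monoid M s)"
  proof (rule isoI)
    show "Union \<in> hom ?MQ (quotient_monoid M s)"
    proof (rule homI)
      show "\<Union> X \<in> carrier (quotient_monoid M s)" if "X \<in> carrier ?MQ" for X
        using that unfolding carr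
        by (auto simp only: Union_quotient_congruence_class carrier_quotient_monoid)
      show "\<Union> (X \<otimes>\<^bsub>?MQ\<^esub> Y) = \<Union> X \<otimes>\<^bsub>quotient_monoid M s\<^esub> \<Union> Y"
        if XY: "X \<in> carrier ?MQ" "Y \<in> carrier ?MQ" for X Y
      proof -
        obtain x y where "x \<in> carrier M" "X = ?Q `` {r `` {x}}" "y \<in> carrier M" "Y = ?Q `` {r `` {y}}"
          using XY unfolding carr by (elim imageE)
        then show ?thesis
          by (simp only: mult_quotient_monoid[OF Q] mult_quotient_monoid[OF r]
              mult_quotient_monoid[OF s] class_in Union_quotient_congruence_class
              monoid_congruence_closed[OF r])
      qed
    qed
    show "bij_betw Union (carrier ?MQ) (carrier (quotient_monoid M s))"
    proof (rule bij_betw_imageI)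
      show "inj_on Union (carrier ?MQ)"
      proof (rule inj_onI)
        fix X Y assume "X \<in> carrier ?MQ" "Y \<in> carrier ?MQ" and eq: "\<Union> X = \<Union> Y"
        then obtain x y where xy: "x \<in> carrier M" "X = ?Q `` {r `` {x}}"
            "y \<in> carrier M" "Y = ?Q `` {r `` {y}}"
          unfolding carr by (elim imageE)
        with eq have "s `` {x} = s `` {y}"
          by (simp only: Union_quotient_congruence_class)
        \<comment> \<open>Equality of \<open>s\<close>-classes is traced back: representatives
          related by \<open>s\<close> have \<open>r\<close>-classes related by
          \<open>?Q\<close>.\<close>
        with xy show "X = Y"
          by (simp only: monoid_congruence_class_eq_iff[OF s] monoid_congruence_class_eq_iff[OF Q]
              class_in quotient_congruence_iff)
      qed
      show "Union ` carrier ?MQ = carrier (quotient_monoid M s)"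
        unfolding carr carrier_quotient_monoid[of M s] image_image
        by (intro image_cong refl Union_quotient_congruence_class)
    qed
  qed
  then show ?thesis
    unfolding is_quotient_of_def is_iso_def using Q by blast
qed

end

section \<open>The grammic action\<close>

lemma gram_act_none: "\<forall>s \<in> {1..n}. a < s \<longrightarrow> g s = 0 \<Longrightarrow> gram_act n g a = g(a := g a + 1)"
  by (auto simp: gram_act_def Let_def)

lemma gram_act_bump:
  assumes "t \<in> {1..n}" "a < t" "g t > 0" "\<forall>s \<in> {1..n}. a < s \<and> s < t \<longrightarrow> g s = 0"
  shows "gram_act n g a = g(a := g a + 1, t := g t - 1)"
proof -
  let ?S = "{s \<in> {1..n}. s > a \<and> g s > 0}"
  have "Min ?S = t"
  proof (rule Min_eqI)
    show "t \<le> s" if "s \<in> ?S" for s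
      using assms(4) that by (force simp flip: not_less)
  qed (use assms in auto)
  moreover have "?S \<noteq> {}"
    using assms by blast
  ultimately show ?thesis
    by (simp only: gram_act_def Let_def if_False)
qed

text \<open>Trades \<open>Min\<close> for a witness \<open>t\<close> with only zero entries strictly
  between \<open>a\<close> and \<open>t\<close>, so that later arguments merely compare
  indices.\<close>

lemma gram_act_cases:
  obtains (none) "\<forall>s \<in> {1..n}. a < s \<longrightarrow> g s = 0" "gram_act n g a = g(a := g a + 1)"
  | (bump) t where "t \<in> {1..n}" "a < t" "g t > 0" "\<forall>s \<in> {1..n}. a < s \<and> s < t \<longrightarrow> g s = 0"
      "gram_act n g a = g(a := g a + 1, t := g t - 1)"
proof (cases "\<exists>t. t \<in> {1..n} \<and> a < t \<and> g t > 0")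
  case True
  define t where "t = (LEAST t. t \<in> {1..n} \<and> a < t \<and> g t > 0)"
  have t: "t \<in> {1..n} \<and> a < t \<and> g t > 0"
    unfolding t_def using True by (rule LeastI_ex)
  have "\<forall>s \<in> {1..n}. a < s \<and> s < t \<longrightarrow> g s = 0"
    using not_less_Least[of _ "\<lambda>t. t \<in> {1..n} \<and> a < t \<and> g t > 0"]
    unfolding t_def[symmetric] by auto
  with t show ?thesis by (intro bump[of t] gram_act_bump) auto
next
  case False
  then have "\<forall>s \<in> {1..n}. a < s \<longrightarrow> g s = 0" by auto
  then show ?thesis by (intro none gram_act_none)
qed

text \<open>Both updated indices lie in \<open>{1..n}\<close>, so the vector remains
  \<open>undefined\<close> outside.\<close>

lemma gram_act_vectors:
  assumes "g \<in> gram_vectors n" "a \<in> {1..n}"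
  shows "gram_act n g a \<in> gram_vectors n"
  using assms
  by (cases rule: gram_act_cases[of n a g]) (auto simp: gram_vectors_def PiE_iff extensional_def)

lemma gram_act_word_vectors:
  "g \<in> gram_vectors n \<Longrightarrow> w \<in> lists {1..n} \<Longrightarrow> gram_act_word n g w \<in> gram_vectors n"
  by (induction w arbitrary: g) (auto simp: gram_act_word_def gram_act_vectors)

lemma gram_act_word_append:
  "gram_act_word n g (u @ v) = gram_act_word n (gram_act_word n g u) v"
  by (simp add: gram_act_word_def)

lemma monoid_congruence_gram: "monoid_congruence (free_monoid {1..n}) (gram_congruence n)"
proof (rule monoid_congruenceI)
  show "(u \<otimes>\<^bsub>free_monoid {1..n}\<^esub> v, u' \<otimes>\<^bsub>free_monoid {1..n}\<^esub> v') \<in> gram_congruence n"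
    if "(u, u') \<in> gram_congruence n" "(v, v') \<in> gram_congruence n" for u u' v v'
    \<comment> \<open>The vector reached after \<open>u\<close> is again in
      \<open>gram_vectors n\<close>, so the agreement of \<open>v\<close> and \<open>v'\<close> can
      be applied there.\<close>
    using that by (simp add: free_monoid_def gram_congruence_def gram_act_word_append gram_act_word_vectors)
qed (auto simp: free_monoid_def gram_congruence_def)

section \<open>Locality of the action and commuting letters\<close>

lemma gram_act_self: "gram_act n g a a = Suc (g a)"
  by (cases rule: gram_act_cases[of n a g]) auto

lemma gram_act_below: "s < a \<Longrightarrow> gram_act n g a s = g s"
  by (cases rule: gram_act_cases[of n a g]) auto

lemma gram_act_pos: "y \<le> u \<Longrightarrow> g y > 0 \<Longrightarrow> gram_act n g u y > 0"
  by (cases "y = u") (auto simp: gram_act_self gram_act_below)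

lemma gram_act_commute:
  assumes y: "y \<in> {1..n}" "g y > 0" and xu: "x < y" "y \<le> u"
  shows "gram_act n (gram_act n g u) x = gram_act n (gram_act n g x) u"
proof (cases rule: gram_act_cases[of n x g])
  case none
  \<comment> \<open>Impossible case: the positive entry at \<open>y\<close> lies beyond
    \<open>x\<close>.\<close>
  with y xu show ?thesis by auto
next
  case (bump t)
  \<comment> \<open>Otherwise \<open>y\<close> would lie strictly between \<open>x\<close> and
    \<open>t\<close>, where all entries vanish.\<close>
  then have t: "t \<le> y"
    using y xu by (metis not_le not_less0)
  \<comment> \<open>After \<open>u\<close>, the letter \<open>x\<close> still decrements at
    \<open>t\<close>: entries below \<open>t\<close> are also below \<open>u\<close> and unchanged,
    and the entry at \<open>t\<close> stays positive since \<open>t\<close> \<le>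
    \<open>u\<close>.\<close>
  have L: "gram_act n (gram_act n g u) x =
      (gram_act n g u)(x := gram_act n g u x + 1, t := gram_act n g u t - 1)"
    using bump t xu by (intro gram_act_bump) (auto simp: gram_act_pos gram_act_below)
  show ?thesis
  proof (cases rule: gram_act_cases[of n u g])
    case none
    \<comment> \<open>The letter \<open>x\<close> changes entries only at \<open>x\<close> and
      \<open>t\<close>, neither beyond \<open>u\<close>, so what \<open>u\<close> sees is the same
      before and after \<open>x\<close>.\<close>
    then have R: "gram_act n (gram_act n g x) u = (gram_act n g x)(u := gram_act n g x u + 1)"
      using bump t xu by (intro gram_act_none) auto
    show ?thesis
      unfolding L R unfolding bump(5) none(2) using bump(2,3) t xu by (auto simp: fun_eq_iff)
  next
    case u: (bump t')
    then have R: "gram_act n (gram_act n g x) u =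
        (gram_act n g x)(u := gram_act n g x u + 1, t' := gram_act n g x t' - 1)"
      using bump t xu by (intro gram_act_bump) auto
    show ?thesis
      \<comment> \<open>From \<open>x\<close> < \<open>t\<close> \<le> \<open>y\<close> \<le>
        \<open>u\<close> < \<open>t'\<close>, the two letters can only meet at \<open>t\<close> =
        \<open>y\<close> = \<open>u\<close>. There \<open>g t > 0\<close> keeps the natural-number
        subtraction exact, so increment and decrement commute.\<close>
      unfolding L R unfolding bump(5) u(5) using bump(2,3) u(2) t xu by (auto simp: fun_eq_iff)
  qed
qed

text \<open>Induction with \<open>g\<close> arbitrary: the tail is treated at the vector reached
  after \<open>u\<close>, where the entry at \<open>y\<close> is still positive, and then
  \<open>x\<close> is exchanged with \<open>u\<close>.\<close>

lemma gram_act_word_commute: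
  assumes "y \<in> {1..n}" "x < y" "\<forall>u \<in> set us. y \<le> u" "g y > 0"
  shows "gram_act_word n g (us @ [x]) = gram_act_word n g (x # us)"
  using assms(3,4)
proof (induction us arbitrary: g)
  case (Cons u us)
  then have "gram_act_word n g ((u # us) @ [x]) = gram_act_word n (gram_act n g u) (x # us)"
    using Cons.IH[of "gram_act n g u"] gram_act_pos by (simp add: gram_act_word_def)
  also have "\<dots> = gram_act_word n g (x # u # us)"
    using gram_act_commute[OF assms(1) _ assms(2)] Cons.prems by (simp add: gram_act_word_def)
  finally show ?case .
qed simp

lemma lps_relations_subset_gram_congruence: "lps_relations n \<subseteq> gram_congruence n"
proof (rule subsetI)
  fix p assume "p \<in> lps_relations n"
  then obtain x y us where p: "p = (y # rev us @ [x], y # x # rev us)"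
    and x: "x \<in> {1..n}" and y: "y \<in> {1..n}" and us: "set us \<subseteq> {1..n}" "us \<noteq> []"
      "x < y" "y \<le> hd us" "sorted_wrt (<) us"
    unfolding lps_relations_def by blast
  have "y \<le> u" if "u \<in> set us" for u
    using us that by (cases us) auto
  \<comment> \<open>The leading letter \<open>y\<close> supplies the positive entry, so the
    commutation applies at \<open>gram_act n g y\<close> for every \<open>g\<close>.\<close>
  then have "gram_act_word n g (y # rev us @ [x]) = gram_act_word n g (y # x # rev us)" for g
    using gram_act_word_commute[OF y us(3), of "rev us" "gram_act n g y"] gram_act_self
    by (simp add: gram_act_word_def)
  then show "p \<in> gram_congruence n"
    using x y us(1) unfolding p gram_congruence_def by auto
qed

theorem corollary6p3:
  fixes n :: nat
  assumes "n \<ge> 1"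
  shows "is_quotient_of (grammic_monoid n) (lps_monoid n)"
  unfolding grammic_monoid_def lps_monoid_def lps_congruence_def
  \<comment> \<open>The grammic congruence both bounds the intersection defining the generated
    congruence and, by minimality, contains it.\<close>
  by (rule is_quotient_of_quotient_monoid[OF
        monoid_congruence_generated[OF monoid_congruence_gram lps_relations_subset_gram_congruence]
        monoid_congruence_gram
        generated_congruence_least[OF monoid_congruence_gram lps_relations_subset_gram_congruence]])

end
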